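(* Let $\mathscr{P}=\{p_\theta:\theta\in\Theta\}$ be a probability model of distributions on $\mathbb{R}^k$, let $\rho$ be a metric (or pseudometric) on $\Theta$, and let the loss function be $\ell(\theta,\hat\theta)=\Phi(\rho(\theta,\hat\theta))$, where $\Phi:\mathbb{R}^+\to\mathbb{R}^+$ is nondecreasing with $\Phi(0)=0$. Let $\delta>0$ and let $\{\theta_1,\ldots,\theta_m\}$, $m\ge2$, be any $2\delta$-packing of $\Theta$. Let $J\sim\mathrm{Unif}\{1,\ldots,m\}$ and, conditioned on $J=j$, let $\mathbf{X}^n=(\mathbf{X}_1,\ldots,\mathbf{X}_n)$ be i.i.d. from $p_{\theta_j}$. Then $$\mathscr{R}_n(\mathscr{P},\ell)\ge\Phi(\delta)\Big(1-\frac{I(J;\mathbf{X}^n)+1}{\log m}\Big).$$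
   Context: An estimator is a (measurable) function $\hat\theta:\mathbb{R}^{kn}\to\Theta$. Its risk is $R_n(\theta,\hat\theta)=\mathsf{E}(\ell(\theta,\hat\theta(\mathbf{X}^n)))$ with $\mathbf{X}_1,\ldots,\mathbf{X}_n$ i.i.d. from $p_\theta$, and the minimax risk is $\mathscr{R}_n(\mathscr{P},\ell)=\inf_{\hat\theta}\sup_{\theta\in\Theta}R_n(\theta,\hat\theta)$. Here a $2\delta$-packing of $\Theta$ is a finite set $\{\theta_1,\ldots,\theta_m\}\subseteq\Theta$ with $\rho(\theta_j,\theta_{j'})\ge2\delta$ for every $j\ne j'$. Logarithms are to base 2 and mutual information $I$ is in bits. $\mathbb{R}^+=[0,\infty)$. *)

theory Defs
  imports "HOL-Probability.Probability"
begin

(* The parameter space is a measurable space \<Theta>; only space \<Theta> and sets \<Theta> are used, so that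
   "measurable estimator" has a meaning for an arbitrary parameter set. *)

definition prob_model ::
  "'t measure \<Rightarrow> ('t \<Rightarrow> (real ^ 'k::finite) measure) \<Rightarrow> bool" where
  "prob_model \<Theta> p \<longleftrightarrow> (\<forall>\<theta>\<in>space \<Theta>. prob_space (p \<theta>) \<and> sets (p \<theta>) = sets borel)"

definition pseudometric_on :: "'t set \<Rightarrow> ('t \<Rightarrow> 't \<Rightarrow> real) \<Rightarrow> bool" where
  "pseudometric_on S \<rho> \<longleftrightarrow>
     (\<forall>x\<in>S. \<rho> x x = 0) \<and>
     (\<forall>x\<in>S. \<forall>y\<in>S. 0 \<le> \<rho> x y) \<and>
     (\<forall>x\<in>S. \<forall>y\<in>S. \<rho> x y = \<rho> y x) \<and>
     (\<forall>x\<in>S. \<forall>y\<in>S. \<forall>z\<in>S. \<rho> x z \<le> \<rho> x y + \<rho> y z)"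

definition packing ::
  "'t set \<Rightarrow> ('t \<Rightarrow> 't \<Rightarrow> real) \<Rightarrow> real \<Rightarrow> nat \<Rightarrow> (nat \<Rightarrow> 't) \<Rightarrow> bool" where
  "packing S \<rho> r m \<theta> \<longleftrightarrow>
     \<theta> ` {1..m} \<subseteq> S \<and> (\<forall>j\<in>{1..m}. \<forall>j'\<in>{1..m}. j \<noteq> j' \<longrightarrow> \<rho> (\<theta> j) (\<theta> j') \<ge> r)"

definition metric_loss :: "(real \<Rightarrow> real) \<Rightarrow> ('t \<Rightarrow> 't \<Rightarrow> real) \<Rightarrow> 't \<Rightarrow> 't \<Rightarrow> real" where
  "metric_loss \<Phi> \<rho> \<theta> \<theta>' = \<Phi> (\<rho> \<theta> \<theta>')"

text \<open>A sample of size \<open>n\<close> is an extensional function on \<open>{1..n}\<close>.\<close>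

abbreviation sample_space :: "nat \<Rightarrow> (nat \<Rightarrow> real ^ 'k::finite) measure" where
  "sample_space n \<equiv> PiM {1..n} (\<lambda>_. borel)"

abbreviation iid_law :: "nat \<Rightarrow> (real ^ 'k::finite) measure \<Rightarrow> (nat \<Rightarrow> real ^ 'k) measure" where
  "iid_law n P \<equiv> PiM {1..n} (\<lambda>_. P)"

definition estimators :: "'t measure \<Rightarrow> nat \<Rightarrow> ((nat \<Rightarrow> real ^ 'k::finite) \<Rightarrow> 't) set" where
  "estimators \<Theta> n = measurable (sample_space n) \<Theta>"

text \<open>The loss may be unbounded, so risks live in \<^typ>\<open>ennreal\<close>.\<close>

definition risk ::
  "('t \<Rightarrow> (real ^ 'k::finite) measure) \<Rightarrow> ('t \<Rightarrow> 't \<Rightarrow> real) \<Rightarrow> nat \<Rightarrow> 't \<Rightarrow>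
     ((nat \<Rightarrow> real ^ 'k) \<Rightarrow> 't) \<Rightarrow> ennreal" where
  "risk p l n \<theta> est = (\<integral>\<^sup>+ x. ennreal (l \<theta> (est x)) \<partial>iid_law n (p \<theta>))"

definition minimax_risk ::
  "'t measure \<Rightarrow> ('t \<Rightarrow> (real ^ 'k::finite) measure) \<Rightarrow> ('t \<Rightarrow> 't \<Rightarrow> real) \<Rightarrow> nat \<Rightarrow> ennreal" where
  "minimax_risk \<Theta> p l n = (INF est\<in>estimators \<Theta> n. SUP \<theta>\<in>space \<Theta>. risk p l n \<theta> est)"

end

(* Given an estimator, let A_j be the event that its loss at \<theta>_j is below \<Phi>(\<delta>). As \<Phi> is monotone, the
   estimate is then within \<delta> of \<theta>_j, so the A_j are disjoint by the packing condition, and the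
   risk at \<theta>_j is at least \<Phi>(\<delta>) (1 - P_j(A_j)). It remains to bound the average of the P_j(A_j) by
   (I + 1) / log m. That average is the mass of A = {(j, x). x \<in> A_j} under the joint law of (J, X),
   while A has mass at most 1/m under the product of the marginals. Fano's inequality is thus
   Gibbs' inequality, applied to the divergence of these two laws and the partition {A, A^c}. *)
theory Submission
  imports Defs
begin

section \<open>Gibbs' inequality for a dominated law\<close>

text \<open>Domination forces absolute continuity. On the set where the derivative exceeds c, its
  excess over c integrates to \<open>N E - c * M E\<close>, which is zero, so the excess vanishes
  almost everywhere.\<close>

lemma AE_RN_deriv_le:
  assumes "prob_space M" and sets: "sets N = sets M"
    and le: "\<And>E. E \<in> sets M \<Longrightarrow> emeasure N E \<le> ennreal c * emeasure M E"
  shows "density M (RN_deriv M N) = N" and "AE x in M. RN_deriv M N x \<le> ennreal c"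
proof -
  interpret prob_space M by fact
  have ac: "absolutely_continuous M N"
    unfolding absolutely_continuous_def
  proof
    fix E assume E: "E \<in> null_sets M"
    then have "emeasure N E \<le> 0" using le[of E] by (auto simp: null_setsD1 null_setsD2)
    with E show "E \<in> null_sets N" using sets by (auto simp: null_sets_def)
  qed
  show dens: "density M (RN_deriv M N) = N"
    using density_RN_deriv ac sets by blast
  define E where "E = {x \<in> space M. ennreal c < RN_deriv M N x}"
  have E[measurable]: "E \<in> sets M" unfolding E_def by measurable
  have "(\<integral>\<^sup>+x. RN_deriv M N x * indicator E x - ennreal c * indicator E x \<partial>M)
      = (\<integral>\<^sup>+x. RN_deriv M N x * indicator E x \<partial>M) - (\<integral>\<^sup>+x. ennreal c * indicator E x \<partial>M)"
  proof (rule nn_integral_diff)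
    show "(\<integral>\<^sup>+x. ennreal c * indicator E x \<partial>M) \<noteq> \<infinity>"
      by (simp add: nn_integral_cmult ennreal_mult_eq_top_iff)
  qed (auto simp: E_def indicator_def)
  also have "\<dots> = emeasure (density M (RN_deriv M N)) E - ennreal c * emeasure M E"
    by (simp add: emeasure_density nn_integral_cmult)
  \<comment> \<open>Subtraction in \<open>ennreal\<close> truncates at 0, so domination makes the
    difference vanish; finiteness of c times \<open>M E\<close> excludes \<open>top - top\<close>,
    which is \<open>top\<close>.\<close>
  also have "\<dots> = 0"
    using le[OF E] ennreal_mult_less_top[of "ennreal c" "emeasure M E"]
    by (auto simp: dens diff_eq_0_iff_ennreal less_top[symmetric] top_unique)
  finally have "AE x in M. RN_deriv M N x * indicator E x - ennreal c * indicator E x = 0"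
    by (subst (asm) nn_integral_0_iff_AE) auto
  then show "AE x in M. RN_deriv M N x \<le> ennreal c"
  proof (rule AE_mp, intro AE_I2 impI)
    fix x assume "x \<in> space M"
      and "RN_deriv M N x * indicator E x - ennreal c * indicator E x = 0"
    then show "RN_deriv M N x \<le> ennreal c"
      by (cases "x \<in> E") (auto simp: E_def diff_eq_0_iff_ennreal not_less)
  qed
qed

text \<open>This is ln t \<le> t - 1 at t = g / f, the pointwise form of Gibbs' inequality. The
  correction term integrates to a nonnegative number once g has no more total mass than f.\<close>

lemma mult_log_ge:
  fixes f g :: real
  assumes "0 \<le> f" "0 < g"
  shows "f * log 2 f \<ge> f * log 2 g + (f - g) / ln 2"
proof (cases "f = 0")
  case False
  with assms have f: "0 < f" by simp
  have "ln (g / f) \<le> g / f - 1" using f assms by (intro ln_le_minus_one) auto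
  then have "f * (ln g - ln f) \<le> f * (g / f - 1)"
    using f assms by (intro mult_left_mono) (auto simp: ln_div)
  then have "f * ln g + (f - g) \<le> f * ln f" using f by (simp add: algebra_simps)
  then have "(f * ln g + (f - g)) / ln 2 \<le> (f * ln f) / ln 2"
    by (intro divide_right_mono) auto
  then show ?thesis by (simp add: log_def add_divide_distrib)
qed (use assms in \<open>simp add: field_simps\<close>)

text \<open>The constant c does not enter the bound: domination makes the entropy density integrable,
  without which the Bochner integral defining the divergence would be the junk value 0.\<close>
lemma KL_divergence_ge_event:
  assumes M: "prob_space M" and N: "prob_space N" and sets: "sets N = sets M"
    and le: "\<And>E. E \<in> sets M \<Longrightarrow> emeasure N E \<le> ennreal c * emeasure M E"
    and A: "A \<in> sets M" and r: "0 < r" and MA: "measure M A \<le> 1 / r"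
  shows "measure N A * log 2 r \<le> KL_divergence 2 M N + 1"
proof -
  interpret M: prob_space M by fact
  interpret N: prob_space N by fact
  note [measurable] = A
  define f where "f x = enn2real (RN_deriv M N x)" for x
  have f[measurable]: "f \<in> borel_measurable M" unfolding f_def by measurable
  have f0: "0 \<le> f x" for x by (simp add: f_def)
  have RN: "AE x in M. RN_deriv M N x \<le> ennreal c"
    and dens: "density M (RN_deriv M N) = N"
    using AE_RN_deriv_le[OF M sets le] by blast+
  \<comment> \<open>No sign of c is assumed, and \<open>ennreal c\<close> is 0 for negative c; hence
    \<open>max c 0\<close>.\<close>
  have fc: "AE x in M. f x \<le> max c 0"
    using RN by eventually_elim (auto simp: f_def enn2real_leI ennreal_max_0 max.commute)
  \<comment> \<open>\<open>enn2real\<close> sends infinity to 0, so passing to the real-valued f is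
    sound only because the derivative is finite almost everywhere.\<close>
  have "density M (RN_deriv M N) = density M (\<lambda>x. ennreal (f x))"
    unfolding f_def
  proof (intro density_cong)
    show "AE x in M. RN_deriv M N x = ennreal (enn2real (RN_deriv M N x))"
      using RN by eventually_elim
        (auto intro!: ennreal_enn2real[symmetric] le_less_trans[OF _ ennreal_less_top])
  qed auto
  with dens have N_eq: "N = density M (\<lambda>x. ennreal (f x))" by simp
  have f_int: "integrable M f"
    by (rule M.integrable_const_bound[where B="max c 0"]) (use fc f0 in auto)
  have f_lint: "(\<integral>x. f x \<partial>M) = 1"
  proof -
    have "ennreal (\<integral>x. f x \<partial>M) = emeasure N (space M)"
      using f_int f0 unfolding N_eq by (simp add: emeasure_density nn_integral_eq_integral)
    also have "\<dots> = 1" using N.emeasure_space_1 sets_eq_imp_space_eq[OF sets] by simp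
    finally show ?thesis by simp
  qed
  have fA_int: "integrable M (\<lambda>x. f x * indicator A x)"
    using f_int by (rule integrable_real_mult_indicator[OF A])
  have fA_lint: "(\<integral>x. f x * indicator A x \<partial>M) = measure N A"
  proof -
    have "ennreal (\<integral>x. f x * indicator A x \<partial>M) = (\<integral>\<^sup>+x. ennreal (f x * indicator A x) \<partial>M)"
      using fA_int f0 by (intro nn_integral_eq_integral[symmetric]) auto
    also have "\<dots> = emeasure N A"
      unfolding N_eq
      by (subst emeasure_density) (auto intro!: nn_integral_cong simp: indicator_def)
    finally show ?thesis by (simp add: N.emeasure_eq_measure integral_nonneg_AE f0)
  qed
  \<comment> \<open>Below, f ln f \<ge> f - 1 \<ge> -1 is the tangent bound with reference value 1;
    above, ln f \<le> f gives f ln f \<le> f * f, which domination keeps bounded.\<close>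
  have log_int: "integrable M (\<lambda>x. f x * log 2 (f x))"
  proof (rule M.integrable_const_bound[where B="(max c 0 * max c 0 + 1) / ln 2"])
    show "AE x in M. norm (f x * log 2 (f x)) \<le> (max c 0 * max c 0 + 1) / ln 2"
      using fc
    proof eventually_elim
      fix x assume x: "f x \<le> max c 0"
      have "- 1 \<le> f x * ln (f x)"
        using mult_log_ge[of "f x" 1] f0[of x] by (simp add: log_def divide_le_cancel)
      moreover have "f x * ln (f x) \<le> f x * f x"
        using f0[of x] ln_bound[of "f x"] by (cases "f x = 0") (auto intro: mult_left_mono)
      moreover have "f x * f x \<le> max c 0 * max c 0"
        using f0[of x] x by (intro mult_mono) auto
      ultimately have "\<bar>f x * ln (f x)\<bar> \<le> max c 0 * max c 0 + 1"
        using zero_le_square[of "max c 0"] by linarith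
      then have "\<bar>f x * ln (f x)\<bar> / ln 2 \<le> (max c 0 * max c 0 + 1) / ln 2"
        by (intro divide_right_mono) auto
      then show "norm (f x * log 2 (f x)) \<le> (max c 0 * max c 0 + 1) / ln 2"
        by (simp add: log_def abs_mult)
    qed
  qed auto
  \<comment> \<open>Gibbs' inequality against the reference density equal to r/2 on A and 1/2 off A,
    whose total mass is at most 1.\<close>
  define h where "h x = log 2 r * (f x * indicator A x) - f x
    + (f x - ((r - 1) / 2 * indicator A x + 1 / 2)) / ln 2" for x
  \<comment> \<open>In bits, log(r/2) = log r - 1 and log(1/2) = -1. The halving thus contributes
    the common term -f, whose integral -1 is the source of the extra bit in Fano's bound.\<close>
  have h_le: "h x \<le> f x * log 2 (f x)" for x
    using mult_log_ge[OF f0, of "r / 2" x] mult_log_ge[OF f0, of "1 / 2" x] r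
    by (cases "x \<in> A") (simp_all add: h_def log_divide algebra_simps diff_divide_distrib)
  have A_int: "integrable M (indicator A :: _ \<Rightarrow> real)"
    by (rule integrable_real_indicator[OF A]) (simp add: less_top[symmetric])
  have h_int: "integrable M h"
    unfolding h_def using f_int fA_int A_int by (intro Bochner_Integration.integrable_add
      Bochner_Integration.integrable_diff integrable_mult_right integrable_divide) auto
  have "(\<integral>x. h x \<partial>M)
      = log 2 r * measure N A - 1 + (1 - ((r - 1) / 2 * measure M A + 1 / 2)) / ln 2"
    unfolding h_def using f_int fA_int A_int
    by (simp add: fA_lint f_lint M.prob_space Bochner_Integration.integral_add
      Bochner_Integration.integral_diff)
  moreover have "(\<integral>x. h x \<partial>M) \<le> (\<integral>x. f x * log 2 (f x) \<partial>M)"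
    using h_int log_int h_le by (intro integral_mono) auto
  moreover have "KL_divergence 2 M N = (\<integral>x. f x * log 2 (f x) \<partial>M)"
    unfolding N_eq by (rule M.KL_density) (auto simp: f0)
  \<comment> \<open>The reference mass is (r * M(A) + M(A^c)) / 2, an average of two numbers that
    are at most 1.\<close>
  moreover have "0 \<le> (1 - ((r - 1) / 2 * measure M A + 1 / 2)) / ln 2"
  proof (rule divide_nonneg_nonneg)
    have "r * measure M A \<le> 1" using MA r by (simp add: field_simps)
    then have "r * measure M A \<le> 1 + measure M A"
      by (rule order_trans) simp
    then show "0 \<le> 1 - ((r - 1) / 2 * measure M A + 1 / 2)"
      by (simp add: field_simps)
  qed auto
  ultimately show ?thesis by (simp add: mult.commute)
qed

section \<open>Fano's inequality for a uniform index\<close>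

text \<open>The slices are disjoint events of the underlying space. Each conjunction is ordered as
  in \<open>cond_prob\<close>, so that a slice can be read as the numerator of a conditional
  probability.\<close>

lemma (in prob_space) distr_pair_finite:
  assumes J: "J \<in> measurable M (count_space I)" and I: "finite I"
    and Y[measurable]: "Y \<in> measurable M T"
    and E[measurable]: "E \<in> sets (count_space I \<Otimes>\<^sub>M T)"
  shows "measure (distr M (count_space I \<Otimes>\<^sub>M T) (\<lambda>\<omega>. (J \<omega>, Y \<omega>))) E
    = (\<Sum>j\<in>I. prob {\<omega> \<in> space M. Y \<omega> \<in> Pair j -` E \<and> J \<omega> = j})"
proof -
  note [measurable] = J
  have parts: "{\<omega> \<in> space M. Y \<omega> \<in> Pair j -` E \<and> J \<omega> = j} \<in> sets M" if "j \<in> I" for j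
  proof -
    have "{\<omega> \<in> space M. Y \<omega> \<in> Pair j -` E \<and> J \<omega> = j}
        = (Y -` (Pair j -` E) \<inter> space M) \<inter> (J -` {j} \<inter> space M)" by auto
    also have "\<dots> \<in> sets M"
      using that
      by (intro sets.Int measurable_sets[OF Y] measurable_sets[OF J] sets_Pair1[OF E]) auto
    finally show ?thesis .
  qed
  have "measure (distr M (count_space I \<Otimes>\<^sub>M T) (\<lambda>\<omega>. (J \<omega>, Y \<omega>))) E
      = prob ((\<lambda>\<omega>. (J \<omega>, Y \<omega>)) -` E \<inter> space M)"
    by (rule measure_distr) auto
  also have "(\<lambda>\<omega>. (J \<omega>, Y \<omega>)) -` E \<inter> space M
      = (\<Union>j\<in>I. {\<omega> \<in> space M. Y \<omega> \<in> Pair j -` E \<and> J \<omega> = j})"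
    using measurable_space[OF J] by auto
  also have "prob \<dots> = (\<Sum>j\<in>I. prob {\<omega> \<in> space M. Y \<omega> \<in> Pair j -` E \<and> J \<omega> = j})"
    by (rule finite_measure_finite_Union) (use parts in \<open>auto simp: I disjoint_family_on_def\<close>)
  finally show ?thesis .
qed

lemma uniform_pair_measure:
  assumes "finite I" and Q: "prob_space Q" and E: "E \<in> sets (count_space I \<Otimes>\<^sub>M Q)"
  shows "measure (uniform_count_measure I \<Otimes>\<^sub>M Q) E
    = (\<Sum>j\<in>I. measure Q (Pair j -` E)) / card I"
proof -
  interpret Q: prob_space Q by fact
  have E': "E \<in> sets (uniform_count_measure I \<Otimes>\<^sub>M Q)"
    using E by (simp add: sets_pair_measure_cong[OF sets_uniform_count_measure_count_space refl])
  have "emeasure (uniform_count_measure I \<Otimes>\<^sub>M Q) E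
      = (\<Sum>j\<in>I. ennreal (1 / card I) * emeasure Q (Pair j -` E))"
    unfolding Q.emeasure_pair_measure_alt[OF E'] unfolding uniform_count_measure_def
    by (rule nn_integral_point_measure_finite) fact
  also have "\<dots> = ennreal ((\<Sum>j\<in>I. measure Q (Pair j -` E)) / card I)"
    by (simp add: Q.emeasure_eq_measure ennreal_mult[symmetric] sum_ennreal sum_divide_distrib)
  finally show ?thesis by (simp add: measure_def sum_nonneg)
qed

text \<open>The A j are the acceptance regions of a test that may abstain: they need not cover the
  sample space. The averaged conditional probability is the chance of a correct decision.\<close>

lemma (in prob_space) fano_uniform:
  assumes J: "J \<in> measurable M (count_space I)" and I: "finite I" "I \<noteq> {}"
    and J_uniform: "distr M (count_space I) J = uniform_count_measure I"
    and Y: "Y \<in> measurable M T"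
    and A: "\<And>j. j \<in> I \<Longrightarrow> A j \<in> sets T" and disj: "disjoint_family_on A I"
  shows "(\<Sum>j\<in>I. \<P>(\<omega> in M. Y \<omega> \<in> A j \<bar> J \<omega> = j)) / card I * log 2 (card I)
    \<le> mutual_information 2 (count_space I) T J Y + 1"
proof -
  note [measurable] = J Y
  define m where "m = real (card I)"
  have m: "m > 0" unfolding m_def using I by (simp add: card_gt_0_iff)
  let ?Q = "distr M T Y"
  let ?P = "distr M (count_space I) J \<Otimes>\<^sub>M ?Q"
  let ?D = "distr M (count_space I \<Otimes>\<^sub>M T) (\<lambda>\<omega>. (J \<omega>, Y \<omega>))"
  interpret Q: prob_space ?Q by (rule prob_space_distr) fact
  interpret DJ: prob_space "distr M (count_space I) J" by (rule prob_space_distr) fact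
  interpret P: pair_prob_space "distr M (count_space I) J" ?Q ..
  interpret D: prob_space ?D by (rule prob_space_distr) simp
  have sets_P: "sets ?P = sets (count_space I \<Otimes>\<^sub>M T)"
    by (intro sets_pair_measure_cong) auto
  have P_eq: "measure ?P E = (\<Sum>j\<in>I. measure ?Q (Pair j -` E)) / m"
    if E: "E \<in> sets (count_space I \<Otimes>\<^sub>M T)" for E
    unfolding J_uniform m_def
  proof (rule uniform_pair_measure[OF I(1) Q.prob_space_axioms])
    show "E \<in> sets (count_space I \<Otimes>\<^sub>M ?Q)"
      using E sets_pair_measure_cong[of "count_space I" "count_space I" ?Q T] by simp
  qed
  \<comment> \<open>Dropping the condition J = j can only enlarge a slice, and the product law gives
    each slice the weight 1/m; hence the factor m.\<close>
  have D_le: "emeasure ?D E \<le> ennreal m * emeasure ?P E" if "E \<in> sets ?P" for E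
  proof -
    have E: "E \<in> sets (count_space I \<Otimes>\<^sub>M T)" using that sets_P by simp
    have "measure ?D E = (\<Sum>j\<in>I. prob {\<omega> \<in> space M. Y \<omega> \<in> Pair j -` E \<and> J \<omega> = j})"
      by (rule distr_pair_finite) fact+
    also have "\<dots> \<le> (\<Sum>j\<in>I. measure ?Q (Pair j -` E))"
    proof (rule sum_mono)
      fix j assume "j \<in> I"
      have S: "Pair j -` E \<in> sets T" using E by (rule sets_Pair1)
      have "measure ?Q (Pair j -` E) = prob (Y -` (Pair j -` E) \<inter> space M)"
        using Y S by (rule measure_distr)
      moreover have "prob {\<omega> \<in> space M. Y \<omega> \<in> Pair j -` E \<and> J \<omega> = j} \<le> \<dots>"
        using measurable_sets[OF Y S] by (intro finite_measure_mono) auto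
      ultimately show "prob {\<omega> \<in> space M. Y \<omega> \<in> Pair j -` E \<and> J \<omega> = j}
        \<le> measure ?Q (Pair j -` E)" by simp
    qed
    also have "\<dots> = m * measure ?P E" using m by (simp add: P_eq[OF E])
    finally show ?thesis
      using m by (simp add: D.emeasure_eq_measure P.emeasure_eq_measure ennreal_mult[symmetric])
  qed
  define B where "B = Sigma I A"
  have B: "B \<in> sets (count_space I \<Otimes>\<^sub>M T)"
  proof -
    have "B = (\<Union>j\<in>I. {j} \<times> A j)" by (auto simp: B_def)
    also have "\<dots> \<in> sets (count_space I \<Otimes>\<^sub>M T)"
      using A I by (intro sets.finite_UN pair_measureI) auto
    finally show ?thesis .
  qed
  have BA: "Pair j -` B = A j" if "j \<in> I" for j using that by (auto simp: B_def)
  have "(\<Sum>j\<in>I. measure ?Q (Pair j -` B)) = (\<Sum>j\<in>I. measure ?Q (A j))"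
    by (simp add: BA)
  also have "\<dots> = measure ?Q (\<Union>j\<in>I. A j)"
    using A disj I by (intro Q.finite_measure_finite_Union[symmetric]) auto
  also have "\<dots> \<le> 1" by simp
  finally have PB: "measure ?P B \<le> 1 / m"
    using m by (simp add: P_eq[OF B] divide_right_mono)
  have J_prob: "prob {\<omega> \<in> space M. J \<omega> = j} = 1 / m" if "j \<in> I" for j
  proof -
    have "prob (J -` {j} \<inter> space M) = measure (distr M (count_space I) J) {j}"
      using that by (intro measure_distr[symmetric]) auto
    also have "\<dots> = 1 / m"
      unfolding J_uniform m_def using that I by (simp add: measure_uniform_count_measure)
    finally show ?thesis by (simp add: vimage_def Int_def conj_commute)
  qed
  have "measure ?D B = (\<Sum>j\<in>I. prob {\<omega> \<in> space M. Y \<omega> \<in> Pair j -` B \<and> J \<omega> = j})"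
    by (rule distr_pair_finite) fact+
  also have "\<dots> = (\<Sum>j\<in>I. \<P>(\<omega> in M. Y \<omega> \<in> A j \<bar> J \<omega> = j) / m)"
    using m by (intro sum.cong) (simp_all add: cond_prob_def J_prob BA)
  finally have DB: "measure ?D B = (\<Sum>j\<in>I. \<P>(\<omega> in M. Y \<omega> \<in> A j \<bar> J \<omega> = j)) / m"
    by (simp add: sum_divide_distrib)
  \<comment> \<open>The number m serves both as the domination constant and as r.
    \<open>KL_divergence\<close> takes the reference law first, here the product of the
    marginals.\<close>
  have "measure ?D B * log 2 m \<le> KL_divergence 2 ?P ?D + 1"
    by (rule KL_divergence_ge_event[OF P.prob_space_axioms D.prob_space_axioms _ D_le _ m PB])
       (use sets_P B in auto)
  then show ?thesis
    unfolding DB mutual_information_def m_def .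
qed

section \<open>From estimation to testing\<close>

text \<open>By the triangle inequality, centres of two open \<delta>-balls with a common point are
  less than 2\<delta> apart. The balls must be open because a packing may attain the separation
  2\<delta>.\<close>

lemma packing_disjoint:
  assumes "pseudometric_on S \<rho>" "packing S \<rho> (2 * \<delta>) m \<theta>"
    and "t \<in> S" "i \<in> {1..m}" "j \<in> {1..m}" "\<rho> (\<theta> i) t < \<delta>" "\<rho> (\<theta> j) t < \<delta>"
  shows "i = j"
proof (rule ccontr)
  assume "i \<noteq> j"
  have S: "\<theta> i \<in> S" "\<theta> j \<in> S" using assms unfolding packing_def by auto
  have "2 * \<delta> \<le> \<rho> (\<theta> i) (\<theta> j)" using assms \<open>i \<noteq> j\<close> unfolding packing_def by auto
  also have "\<dots> \<le> \<rho> (\<theta> i) t + \<rho> t (\<theta> j)"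
    using assms(1,3) S unfolding pseudometric_on_def by blast
  also have "\<rho> t (\<theta> j) = \<rho> (\<theta> j) t"
    using assms(1,3) S unfolding pseudometric_on_def by blast
  finally show False using assms by simp
qed

theorem theorem0p12:
  fixes \<Theta> :: "'t measure"
    and p :: "'t \<Rightarrow> (real ^ 'k::finite) measure"
    and \<rho> :: "'t \<Rightarrow> 't \<Rightarrow> real"
    and \<Phi> :: "real \<Rightarrow> real"
    and \<delta> :: real
    and n m :: nat
    and \<theta> :: "nat \<Rightarrow> 't"
    and M :: "'w measure"
    and J :: "'w \<Rightarrow> nat"
    and X :: "nat \<Rightarrow> 'w \<Rightarrow> real ^ 'k"
  assumes model: "prob_model \<Theta> p"
    and pseudometric: "pseudometric_on (space \<Theta>) \<rho>"
    and Phi_nonneg: "\<Phi> \<in> {0..} \<rightarrow> {0..}"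
    and Phi_mono: "mono_on {0..} \<Phi>"
    and Phi_0: "\<Phi> 0 = 0"
    and loss_measurable: "\<And>t. t \<in> space \<Theta> \<Longrightarrow> metric_loss \<Phi> \<rho> t \<in> borel_measurable \<Theta>"
    and delta_pos: "\<delta> > 0"
    and m_ge_2: "m \<ge> 2"
    and packing: "packing (space \<Theta>) \<rho> (2 * \<delta>) m \<theta>"
    and prob_M: "prob_space M"
    and J_measurable: "J \<in> measurable M (count_space {1..m})"
    and J_uniform: "distr M (count_space {1..m}) J = uniform_count_measure {1..m}"
    and X_measurable: "\<And>i. i \<in> {1..n} \<Longrightarrow> X i \<in> borel_measurable M"
    and X_iid_given_J: "\<And>j A. j \<in> {1..m} \<Longrightarrow> A \<in> sets (sample_space n) \<Longrightarrow>
           \<P>(\<omega> in M. (\<lambda>i\<in>{1..n}. X i \<omega>) \<in> A \<bar> J \<omega> = j) = measure (iid_law n (p (\<theta> j))) A"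
  shows "enn2ereal (minimax_risk \<Theta> p (metric_loss \<Phi> \<rho>) n) \<ge>
           ereal (\<Phi> \<delta> * (1 - (prob_space.mutual_information M 2 (count_space {1..m}) (sample_space n)
                                  J (\<lambda>\<omega>. \<lambda>i\<in>{1..n}. X i \<omega>) + 1) / log 2 (real m)))"
proof -
  interpret prob_space M by fact
  let ?Y = "\<lambda>\<omega>. \<lambda>i\<in>{1..n}. X i \<omega>"
  let ?l = "metric_loss \<Phi> \<rho>"
  define MI where "MI = mutual_information 2 (count_space {1..m}) (sample_space n) J ?Y"
  have Y: "?Y \<in> measurable M (sample_space n)"
    using X_measurable by (intro measurable_restrict) auto
  have logm: "log 2 (real m) > 0" using m_ge_2 by simp
  have \<Phi>\<delta>: "0 \<le> \<Phi> \<delta>" using Phi_nonneg delta_pos by auto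
  have \<theta>: "\<theta> j \<in> space \<Theta>" if "j \<in> {1..m}" for j
    using packing that unfolding packing_def by auto
  have "ennreal (\<Phi> \<delta> * (1 - (MI + 1) / log 2 (real m))) \<le> minimax_risk \<Theta> p ?l n"
    unfolding minimax_risk_def
  proof (rule INF_greatest)
    fix est :: "(nat \<Rightarrow> real ^ 'k) \<Rightarrow> 't" assume "est \<in> estimators \<Theta> n"
    then have est: "est \<in> measurable (sample_space n) \<Theta>" by (simp add: estimators_def)
    \<comment> \<open>The nearest-point test cannot be used: it need not be measurable, since only the
      losses, not the distances, are assumed to be.\<close>
    define A where "A j = {x \<in> space (sample_space n). ?l (\<theta> j) (est x) < \<Phi> \<delta>}" for j
    have l_meas: "(\<lambda>x. ?l (\<theta> j) (est x)) \<in> borel_measurable (sample_space n)"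
      if "j \<in> {1..m}" for j
      using measurable_compose[OF est loss_measurable[OF \<theta>[OF that]]] .
    have A: "A j \<in> sets (sample_space n)" if "j \<in> {1..m}" for j
      unfolding A_def using l_meas[OF that] by measurable
    \<comment> \<open>Contrapositive of monotonicity. The strict inequality in \<open>A\<close>
      matters: where \<Phi> is flat, a weak one would also admit points at distance \<delta> or
      more.\<close>
    have A_close: "\<rho> (\<theta> j) (est x) < \<delta> \<and> est x \<in> space \<Theta>"
      if "j \<in> {1..m}" "x \<in> A j" for j x
    proof -
      have x: "est x \<in> space \<Theta>" using that measurable_space[OF est] by (auto simp: A_def)
      have "\<not> \<delta> \<le> \<rho> (\<theta> j) (est x)"
        using mono_onD[OF Phi_mono, of \<delta> "\<rho> (\<theta> j) (est x)"] that(2) delta_pos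
        by (auto simp: A_def metric_loss_def)
      with x show ?thesis by simp
    qed
    have disj: "disjoint_family_on A {1..m}"
      unfolding disjoint_family_on_def
      using packing_disjoint[OF pseudometric packing] A_close by blast
    define a where "a j = measure (iid_law n (p (\<theta> j))) (A j)" for j
    have "(\<Sum>j=1..m. \<P>(\<omega> in M. ?Y \<omega> \<in> A j \<bar> J \<omega> = j)) = (\<Sum>j=1..m. a j)"
      unfolding a_def by (intro sum.cong refl X_iid_given_J A)
    then have fano: "(\<Sum>j=1..m. a j) / m * log 2 m \<le> MI + 1"
      using fano_uniform[OF J_measurable _ _ J_uniform Y A disj] m_ge_2 by (simp add: MI_def)
    \<comment> \<open>Some \<open>a j\<close> is at most the average. A single such index already
      bounds the supremum of the risks from below, so the risks themselves need not be
      averaged.\<close>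
    have "\<exists>j\<in>{1..m}. a j \<le> (MI + 1) / log 2 m"
    proof (rule ccontr)
      assume "\<not> ?thesis"
      then have "(\<Sum>j=1..m. (MI + 1) / log 2 m) < (\<Sum>j=1..m. a j)"
        using m_ge_2 by (intro sum_strict_mono) (auto simp: not_le)
      with fano logm m_ge_2 show False by (simp add: field_simps)
    qed
    then obtain j where j: "j \<in> {1..m}" and aj: "a j \<le> (MI + 1) / log 2 m" by blast
    let ?P = "iid_law n (p (\<theta> j))"
    have p: "prob_space (p (\<theta> j))" "sets (p (\<theta> j)) = sets borel"
      using model \<theta>[OF j] unfolding prob_model_def by auto
    have setsP: "sets ?P = sets (sample_space n)" using p by (intro sets_PiM_cong) auto
    note spaceP = sets_eq_imp_space_eq[OF setsP]
    interpret P: prob_space ?P using p by (intro prob_space_PiM) auto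
    have AP: "A j \<in> sets ?P" using A[OF j] setsP by simp
    \<comment> \<open>Keeps \<open>1 - a j\<close> nonnegative, so that \<open>ennreal\<close> does
      not truncate a factor when the product is split.\<close>
    have a_le: "a j \<le> 1" unfolding a_def by (rule P.prob_le_1)
    have "ennreal (\<Phi> \<delta> * (1 - (MI + 1) / log 2 m)) \<le> ennreal (\<Phi> \<delta> * (1 - a j))"
      using aj \<Phi>\<delta> by (intro ennreal_leI mult_left_mono) auto
    also have "\<dots> = ennreal (\<Phi> \<delta>) * emeasure ?P (space ?P - A j)"
      unfolding P.emeasure_eq_measure P.prob_compl[OF AP] a_def[symmetric]
      using \<Phi>\<delta> by (rule ennreal_mult) (simp add: a_le)
    also have "\<dots> = (\<integral>\<^sup>+x. ennreal (\<Phi> \<delta>) * indicator (space ?P - A j) x \<partial>?P)"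
      using AP by (subst nn_integral_cmult_indicator) auto
    also have "\<dots> \<le> risk p ?l n (\<theta> j) est"
      unfolding risk_def
    proof (rule nn_integral_mono)
      fix x assume "x \<in> space ?P"
      then have "x \<in> space (sample_space n)" unfolding spaceP .
      then show "ennreal (\<Phi> \<delta>) * indicator (space ?P - A j) x \<le> ennreal (?l (\<theta> j) (est x))"
        by (auto simp: A_def indicator_def not_less intro!: ennreal_leI)
    qed
    also have "\<dots> \<le> (SUP t\<in>space \<Theta>. risk p ?l n t est)"
      using \<theta>[OF j] by (rule SUP_upper)
    finally show "ennreal (\<Phi> \<delta> * (1 - (MI + 1) / log 2 m))
      \<le> (SUP t\<in>space \<Theta>. risk p ?l n t est)" .
  qed
  then have "enn2ereal (ennreal (\<Phi> \<delta> * (1 - (MI + 1) / log 2 (real m))))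
      \<le> enn2ereal (minimax_risk \<Theta> p ?l n)"
    by (simp add: less_eq_ennreal.rep_eq)
  \<comment> \<open>A negative Fano bound becomes 0 in \<open>ennreal\<close>; the truncation only
    raises the lower bound already proved.\<close>
  moreover have "ereal x \<le> enn2ereal (ennreal x)" for x
    by (cases "0 \<le> x") (auto simp: enn2ereal_ennreal ennreal_neg zero_ennreal.rep_eq)
  ultimately show ?thesis
    unfolding MI_def by (rule order_trans[rotated])
qed

end
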